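(* Let $G$ be a connected graph of order $n$. Then $$\frac{\sigma_1(G)}{\sigma_0(G)} \ge \frac{\sigma_1(S_n)}{\sigma_0(S_n)} = \frac{n-1}{2^{n-1}+1},$$ with equality if and only if $G = S_n$.
   Context: All graphs are finite and simple. For a graph $G$ and an integer $k\ge 0$, $\sigma_k(G)$ denotes the number of subsets $A\subseteq V(G)$ such that the subgraph of $G$ induced by $A$ has exactly $k$ edges. Thus $\sigma_0(G)$ is the number of independent vertex subsets of $G$ (including the empty set), and $\sigma_1(G)$ is the number of vertex subsets inducing exactly one edge. The order of $G$ is its number of vertices. $S_n$ denotes the star with $n$ vertices (one centre joined to $n-1$ leaves; $S_1$ is a single vertex). Equality of graphs is understood up to isomorphism. *)

theory Defs
  imports Complex_Main
begin

datatype 'a graph = Graph (verts: "'a set") (edges: "'a set set")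

definition simple_graph :: "'a graph \<Rightarrow> bool" where
  "simple_graph G \<longleftrightarrow>
     finite (verts G) \<and> (\<forall>e\<in>edges G. e \<subseteq> verts G \<and> card e = 2)"

definition order :: "'a graph \<Rightarrow> nat" where
  "order G = card (verts G)"

definition adj_rel :: "'a graph \<Rightarrow> ('a \<times> 'a) set" where
  "adj_rel G = {(u, v). {u, v} \<in> edges G}"

(* The graph without vertices is not counted as connected. *)
definition connected_graph :: "'a graph \<Rightarrow> bool" where
  "connected_graph G \<longleftrightarrow>
     verts G \<noteq> {} \<and> (\<forall>u\<in>verts G. \<forall>v\<in>verts G. (u, v) \<in> (adj_rel G)\<^sup>*)"

definition induced_subgraph :: "'a graph \<Rightarrow> 'a set \<Rightarrow> 'a graph" where
  "induced_subgraph G A = Graph A {e \<in> edges G. e \<subseteq> A}"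

definition sigma :: "nat \<Rightarrow> 'a graph \<Rightarrow> nat" where
  "sigma k G = card {A. A \<subseteq> verts G \<and> card (edges (induced_subgraph G A)) = k}"

definition star :: "nat \<Rightarrow> nat graph" where
  "star n = Graph {0..<n} {{0, i} | i. 1 \<le> i \<and> i < n}"

definition graph_iso :: "'a graph \<Rightarrow> 'b graph \<Rightarrow> bool" where
  "graph_iso G H \<longleftrightarrow>
     (\<exists>f. bij_betw f (verts G) (verts H) \<and>
          (\<forall>u\<in>verts G. \<forall>v\<in>verts G. {u, v} \<in> edges G \<longleftrightarrow> {f u, f v} \<in> edges H))"

end

theory Submission
  imports Defs
begin

text \<open>
  The numerator and the denominator are extremal separately. Every edge is itself a vertex set
  inducing exactly one edge, and a connected graph has at least \<open>n - 1\<close> edges, so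
  \<open>\<sigma>\<^sub>1(G) \<ge> n - 1\<close>. For the denominator, pair each vertex set with its complement. If both members
  of a pair are independent, they form a bipartition of \<open>G\<close>, and a connected graph has at most one.
  Hence all but at most one of the \<open>2 ^ (n - 1)\<close> pairs contain at most one independent set, and
  \<open>\<sigma>\<^sub>0(G) \<le> 2 ^ (n - 1) + 1\<close>. The star attains both bounds.

  For \<open>n \<ge> 2\<close>, equality of the ratios forces equality in the second bound
  (\<open>equality_imp_bipartition_and_half_independent\<close>): a bipartition exists, and of any
  two complementary sets one is independent. The second property, applied to an edge and its
  complement, shows that any two edges meet. A family of pairwise meeting edges is contained in
  a triangle or has a common vertex; the triangle is not bipartite, so there is a common vertex,
  and by connectedness it is joined to all the others.
\<close>

section \<open>Independent sets and sets inducing one edge\<close>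

definition independent_sets :: "'a graph \<Rightarrow> 'a set set" where
  "independent_sets G = {A. A \<subseteq> verts G \<and> (\<forall>e\<in>edges G. \<not> e \<subseteq> A)}"

lemma finite_edges:
  assumes "simple_graph G"
  shows "finite (edges G)"
proof (rule finite_subset)
  show "edges G \<subseteq> Pow (verts G)" using assms by (auto simp: simple_graph_def)
  show "finite (Pow (verts G))" using assms by (simp add: simple_graph_def)
qed

lemma finite_independent_sets:
  assumes "simple_graph G"
  shows "finite (independent_sets G)"
  using assms by (auto simp: simple_graph_def independent_sets_def)

lemma edge_endpoints:
  assumes "simple_graph G" and "{u, v} \<in> edges G"
  shows "u \<in> verts G" "v \<in> verts G" "u \<noteq> v"
  using assms by (auto simp: simple_graph_def)

lemma edge_as_pair:
  assumes "simple_graph G" and "e \<in> edges G"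
  obtains u v where "e = {u, v}" "u \<noteq> v"
  using assms by (metis simple_graph_def card_2_iff)

lemma sigma_0_eq:
  assumes "simple_graph G"
  shows "sigma 0 G = card (independent_sets G)"
proof -
  have "card {e \<in> edges G. e \<subseteq> A} = 0 \<longleftrightarrow> (\<forall>e\<in>edges G. \<not> e \<subseteq> A)" for A
    using finite_edges[OF assms] by auto
  then show ?thesis
    by (simp add: sigma_def induced_subgraph_def independent_sets_def)
qed

lemma sigma_0_pos:
  assumes "simple_graph G"
  shows "sigma 0 G > 0"
proof -
  have "{} \<in> independent_sets G"
    using assms by (auto simp: independent_sets_def simple_graph_def)
  then show ?thesis
    unfolding sigma_0_eq[OF assms]
    using finite_independent_sets[OF assms] by (auto simp: card_gt_0_iff)
qed

lemma card_edges_le_sigma_1: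
  assumes "simple_graph G"
  shows "card (edges G) \<le> sigma 1 G"
proof -
  have fin: "finite (verts G)" using assms by (simp add: simple_graph_def)
  have "card {e' \<in> edges G. e' \<subseteq> e} = 1" if "e \<in> edges G" for e
  proof -
    have "e' = e" if "e' \<in> edges G" "e' \<subseteq> e" for e'
      using that \<open>e \<in> edges G\<close> assms
      by (intro card_subset_eq) (auto simp: simple_graph_def intro: finite_subset)
    then have "{e' \<in> edges G. e' \<subseteq> e} = {e}" using that by blast
    then show ?thesis by simp
  qed
  then have "edges G \<subseteq> {A. A \<subseteq> verts G \<and> card (edges (induced_subgraph G A)) = 1}"
    using assms by (auto simp: induced_subgraph_def simple_graph_def)
  then show ?thesis
    unfolding sigma_def by (rule card_mono[rotated]) (use fin in simp)
qed

section \<open>Counting edges of a connected graph\<close>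

text \<open>
  Join each vertex other than a root to a neighbour that is closer to the root. An edge obtained
  in this way has a unique endpoint farther from the root, so distinct vertices yield distinct
  edges.
\<close>
lemma connected_card_edges_ge:
  assumes sg: "simple_graph G" and conn: "connected_graph G"
  shows "card (verts G) - 1 \<le> card (edges G)"
proof -
  obtain r where r: "r \<in> verts G" using conn by (auto simp: connected_graph_def)
  define d where "d v = (LEAST k. (r, v) \<in> adj_rel G ^^ k)" for v
  have "\<exists>p. {p, v} \<in> edges G \<and> d p < d v" if v: "v \<in> verts G - {r}" for v
  proof -
    have "(r, v) \<in> (adj_rel G)\<^sup>*" using conn r v by (auto simp: connected_graph_def)
    then obtain k where "(r, v) \<in> adj_rel G ^^ k" by (auto simp: rtrancl_power)
    then have dv: "(r, v) \<in> adj_rel G ^^ d v" unfolding d_def by (rule LeastI)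
    with v obtain m where m: "d v = Suc m" by (cases "d v") auto
    with dv obtain p where p: "(r, p) \<in> adj_rel G ^^ m" "(p, v) \<in> adj_rel G" by auto
    have "d p \<le> m" unfolding d_def by (rule Least_le) (rule p(1))
    with p(2) m show ?thesis by (auto simp: adj_rel_def)
  qed
  then obtain p where p: "\<And>v. v \<in> verts G - {r} \<Longrightarrow> {p v, v} \<in> edges G \<and> d (p v) < d v"
    by metis
  have "inj_on (\<lambda>v. {p v, v}) (verts G - {r})"
  proof (rule inj_onI)
    fix v w assume vw: "v \<in> verts G - {r}" "w \<in> verts G - {r}" "{p v, v} = {p w, w}"
    show "v = w"
    proof (rule ccontr)
      assume "v \<noteq> w"
      with vw(3) have "v = p w" "w = p v" by (auto simp: doubleton_eq_iff)
      moreover have "d (p v) < d v" "d (p w) < d w" using p vw(1,2) by blast+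
      ultimately show False by (metis order.asym)
    qed
  qed
  moreover have "(\<lambda>v. {p v, v}) ` (verts G - {r}) \<subseteq> edges G" using p by auto
  ultimately have "card (verts G - {r}) \<le> card (edges G)"
    using finite_edges[OF sg] by (rule card_inj_on_le)
  then show ?thesis using r by simp
qed

section \<open>Counting independent sets of a connected graph\<close>

definition bipartition_classes :: "'a graph \<Rightarrow> 'a set set" where
  "bipartition_classes G = {A \<in> independent_sets G. verts G - A \<in> independent_sets G}"

lemma bipartition_class_alternates:
  assumes "A \<in> bipartition_classes G" and "simple_graph G" and "{u, v} \<in> edges G"
  shows "v \<in> A \<longleftrightarrow> u \<notin> A"
proof -
  have "\<not> {u, v} \<subseteq> A" "\<not> {u, v} \<subseteq> verts G - A"
    using assms(1,3) by (auto simp only: bipartition_classes_def independent_sets_def mem_Collect_eq)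
  then show ?thesis using edge_endpoints[OF assms(2,3)] by auto
qed

text \<open>
  Crossing an edge switches the class in every bipartition. Thus two bipartition classes that agree
  at one vertex agree along every path, and two that disagree at one vertex disagree everywhere.
\<close>
lemma bipartition_classes_unique:
  assumes sg: "simple_graph G" and conn: "connected_graph G"
    and A: "A \<in> bipartition_classes G" and B: "B \<in> bipartition_classes G"
  shows "B = A \<or> B = verts G - A"
proof -
  obtain r where r: "r \<in> verts G" using conn by (auto simp: connected_graph_def)
  have agree: "(v \<in> A \<longleftrightarrow> v \<in> B) \<longleftrightarrow> (r \<in> A \<longleftrightarrow> r \<in> B)" if v: "v \<in> verts G" for v
  proof -
    have "(r, v) \<in> (adj_rel G)\<^sup>*" using conn r v by (auto simp: connected_graph_def)
    then show ?thesis
    proof induction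
      case (step y z)
      then have "{y, z} \<in> edges G" by (simp add: adj_rel_def)
      then show ?case
        using step.IH bipartition_class_alternates[OF A sg] bipartition_class_alternates[OF B sg]
        by blast
    qed simp
  qed
  have "A \<subseteq> verts G" "B \<subseteq> verts G"
    using A B by (auto simp: bipartition_classes_def independent_sets_def)
  with agree show ?thesis by (cases "r \<in> A \<longleftrightarrow> r \<in> B") auto
qed

lemma card_bipartition_classes_le_2:
  assumes "simple_graph G" and "connected_graph G"
  shows "card (bipartition_classes G) \<le> 2"
proof (cases "bipartition_classes G = {}")
  case False
  then obtain A where "A \<in> bipartition_classes G" by blast
  then have "bipartition_classes G \<subseteq> {A, verts G - A}"
    using bipartition_classes_unique[OF assms] by blast
  then have "card (bipartition_classes G) \<le> card {A, verts G - A}"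
    by (rule card_mono[rotated]) simp
  also have "\<dots> \<le> 2" by (simp add: card_insert_if)
  finally show ?thesis .
qed simp

text \<open>
  Inclusion-exclusion for the independent sets and their complements: the two families are
  equinumerous, and they overlap exactly in the bipartition classes.
\<close>
lemma double_card_independent_sets:
  assumes "simple_graph G"
  shows "2 * card (independent_sets G) =
    card (independent_sets G \<union> (\<lambda>A. verts G - A) ` independent_sets G)
    + card (bipartition_classes G)"
proof -
  let ?I = "independent_sets G" and ?c = "\<lambda>A. verts G - A"
  have sub: "A \<subseteq> verts G" if "A \<in> ?I" for A
    using that by (simp add: independent_sets_def)
  have "inj_on ?c ?I" by (rule inj_onI) (use sub in blast)
  then have "card (?c ` ?I) = card ?I" by (rule card_image)
  moreover have "?I \<inter> ?c ` ?I = bipartition_classes G"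
  proof -
    have "A \<in> ?c ` ?I \<longleftrightarrow> ?c A \<in> ?I" if "A \<in> ?I" for A
    proof
      assume "A \<in> ?c ` ?I"
      then obtain B where B: "B \<in> ?I" "A = ?c B" by (rule imageE)
      then have "?c A = B" using sub[OF B(1)] by (simp only: double_diff subset_refl)
      with B show "?c A \<in> ?I" by (simp only:)
    next
      assume "?c A \<in> ?I"
      then show "A \<in> ?c ` ?I"
        using sub[OF that] by (intro image_eqI[of _ _ "?c A"]) (simp_all only: double_diff subset_refl)
    qed
    then show ?thesis by (simp only: bipartition_classes_def set_eq_iff Int_iff mem_Collect_eq) blast
  qed
  ultimately show ?thesis
    using card_Un_Int[of ?I "?c ` ?I"] finite_independent_sets[OF assms] by simp
qed

lemma independent_sets_and_complements_subset:
  "independent_sets G \<union> (\<lambda>A. verts G - A) ` independent_sets G \<subseteq> Pow (verts G)"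
  by (auto simp: independent_sets_def)

lemma card_Pow_verts:
  assumes "simple_graph G" and "connected_graph G"
  shows "card (Pow (verts G)) = 2 * 2 ^ (card (verts G) - 1)"
proof -
  have "card (verts G) \<noteq> 0" "finite (verts G)"
    using assms by (auto simp: simple_graph_def connected_graph_def)
  then show ?thesis by (simp add: card_Pow power_eq_if)
qed

lemma card_independent_sets_le:
  assumes "simple_graph G" and "connected_graph G"
  shows "card (independent_sets G) \<le> 2 ^ (card (verts G) - 1) + 1"
proof -
  have "finite (Pow (verts G))" using assms by (simp add: simple_graph_def)
  from card_mono[OF this independent_sets_and_complements_subset]
  show ?thesis
    using double_card_independent_sets[OF assms(1)] card_bipartition_classes_le_2[OF assms]
      card_Pow_verts[OF assms] by linarith
qed

lemma equality_imp_bipartition_and_half_independent: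
  assumes sg: "simple_graph G" and conn: "connected_graph G"
    and eq: "card (independent_sets G) = 2 ^ (card (verts G) - 1) + 1"
  shows "bipartition_classes G \<noteq> {}"
    and "\<And>X. X \<subseteq> verts G \<Longrightarrow> X \<in> independent_sets G \<or> verts G - X \<in> independent_sets G"
proof -
  let ?U = "independent_sets G \<union> (\<lambda>A. verts G - A) ` independent_sets G"
  have fin: "finite (Pow (verts G))" using sg by (simp add: simple_graph_def)
  have le: "card ?U \<le> card (Pow (verts G))"
    using card_mono[OF fin independent_sets_and_complements_subset] .
  note dbl = double_card_independent_sets[OF sg] card_bipartition_classes_le_2[OF sg conn]
    card_Pow_verts[OF sg conn]
  have "card (bipartition_classes G) = 2" using le dbl eq by linarith
  then show "bipartition_classes G \<noteq> {}" by auto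
  have "card ?U = card (Pow (verts G))" using le dbl eq by linarith
  then have U: "?U = Pow (verts G)"
    using card_subset_eq[OF fin independent_sets_and_complements_subset] by blast
  show "X \<in> independent_sets G \<or> verts G - X \<in> independent_sets G" if "X \<subseteq> verts G" for X
  proof -
    have "X \<in> ?U" unfolding U using that by (rule PowI)
    then show ?thesis
    proof
      assume "X \<in> (\<lambda>A. verts G - A) ` independent_sets G"
      then obtain B where B: "B \<in> independent_sets G" "X = verts G - B" by (rule imageE)
      then have "verts G - X = B" by (auto simp: independent_sets_def)
      with B(1) show ?thesis by simp
    qed simp
  qed
qed

section \<open>Stars\<close>

text \<open>
  This is isomorphism to the standard star, stated within \<open>G\<close>; the two counts can then be computed
  without transporting them along an isomorphism.
\<close>
definition star_centre :: "'a graph \<Rightarrow> 'a \<Rightarrow> bool" where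
  "star_centre G c \<longleftrightarrow> c \<in> verts G \<and> edges G = {{c, w} | w. w \<in> verts G - {c}}"

lemma star_centre_star:
  assumes "n > 0"
  shows "star_centre (star n) 0"
  unfolding star_centre_def star_def using assms
  by (auto simp: Suc_le_eq)

lemma simple_graph_star: "simple_graph (star n)"
  unfolding star_def simple_graph_def by auto

lemma card_independent_sets_star:
  assumes sg: "simple_graph G" and c: "star_centre G c"
  shows "card (independent_sets G) = 2 ^ (card (verts G) - 1) + 1"
proof -
  have fin: "finite (verts G)" using sg by (simp add: simple_graph_def)
  have "independent_sets G = insert {c} (Pow (verts G - {c}))"
  proof -
    have edge: "{c, w} \<in> edges G" if "w \<in> verts G" "w \<noteq> c" for w
      using c that by (auto simp: star_centre_def)
    have "c \<in> e" "\<not> e \<subseteq> {c}" if "e \<in> edges G" for e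
      using c that by (auto simp: star_centre_def)
    then have "insert {c} (Pow (verts G - {c})) \<subseteq> independent_sets G"
      using c by (auto simp: independent_sets_def star_centre_def)
    moreover have "A = {c}" if "A \<in> independent_sets G" "c \<in> A" for A
    proof -
      have "w = c" if "w \<in> A" for w
      proof (rule ccontr)
        assume "w \<noteq> c"
        with edge[of w] \<open>A \<in> _\<close> that have "\<not> {c, w} \<subseteq> A"
          by (auto simp: independent_sets_def simp del: insert_subset)
        with that \<open>c \<in> A\<close> show False by simp
      qed
      with \<open>c \<in> A\<close> show ?thesis by blast
    qed
    moreover have "A \<in> Pow (verts G - {c})" if "A \<in> independent_sets G" "c \<notin> A" for A
      using that by (simp add: independent_sets_def subset_Diff_insert)
    ultimately show ?thesis by (intro subset_antisym subsetI) (blast, rule subsetD)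
  qed
  moreover have "{c} \<notin> Pow (verts G - {c})" by auto
  ultimately show ?thesis
    using c fin by (simp add: card_Pow star_centre_def)
qed

lemma sigma_1_star:
  assumes sg: "simple_graph G" and c: "star_centre G c"
  shows "sigma 1 G = card (verts G) - 1"
proof -
  have fin: "finite (verts G)" using sg by (simp add: simple_graph_def)
  have inj: "inj_on (\<lambda>w. {c, w}) X" if "c \<notin> X" for X
    using that by (auto simp: inj_on_def doubleton_eq_iff)
  have induced: "card {e \<in> edges G. e \<subseteq> A} = (if c \<in> A then card (A - {c}) else 0)"
    if A: "A \<subseteq> verts G" for A
  proof (cases "c \<in> A")
    case True
    then have "{e \<in> edges G. e \<subseteq> A} = (\<lambda>w. {c, w}) ` (A - {c})"
      using A c by (auto simp: star_centre_def)
    then show ?thesis using True by (simp add: card_image inj)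
  next
    case False
    then have none: "{e \<in> edges G. e \<subseteq> A} = {}" using c by (auto simp: star_centre_def)
    show ?thesis unfolding none using False by simp
  qed
  have "{A. A \<subseteq> verts G \<and> card {e \<in> edges G. e \<subseteq> A} = 1} =
      (\<lambda>w. {c, w}) ` (verts G - {c})" (is "?S = ?T")
  proof
    show "?S \<subseteq> ?T"
    proof
      fix A assume "A \<in> ?S"
      then have A: "A \<subseteq> verts G" "c \<in> A" "card (A - {c}) = 1"
        by (auto simp: induced split: if_splits)
      obtain w where "A - {c} = {w}" using A(3) by (rule card_1_singletonE)
      with A have "A = {c, w}" "w \<in> verts G - {c}" by auto
      then show "A \<in> ?T" by blast
    qed
    show "?T \<subseteq> ?S"
    proof
      fix A assume "A \<in> ?T"
      then obtain w where w: "A = {c, w}" "w \<in> verts G" "w \<noteq> c" by auto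
      then have "A \<subseteq> verts G" "A - {c} = {w}" using c by (auto simp: star_centre_def)
      with w show "A \<in> ?S" by (simp add: induced)
    qed
  qed
  then show ?thesis
    using c fin by (simp add: sigma_def induced_subgraph_def card_image inj star_centre_def)
qed

lemma graph_iso_star_iff:
  assumes sg: "simple_graph G" and n: "card (verts G) = n" "n > 0"
  shows "graph_iso G (star n) \<longleftrightarrow> (\<exists>c. star_centre G c)"
proof
  assume "graph_iso G (star n)"
  then obtain f where bij: "bij_betw f (verts G) {0..<n}"
    and f: "\<And>u v. u \<in> verts G \<Longrightarrow> v \<in> verts G \<Longrightarrow>
      {u, v} \<in> edges G \<longleftrightarrow> {f u, f v} \<in> edges (star n)"
    by (auto simp: graph_iso_def star_def)
  obtain c where c: "c \<in> verts G" "f c = 0"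
    using bij n(2) by (metis bij_betw_imp_surj_on atLeastLessThan_iff imageE le0)
  have edge0: "{i, j} \<in> edges (star n) \<longleftrightarrow> i < n \<and> j < n \<and> i \<noteq> j \<and> (i = 0 \<or> j = 0)" for i j
    by (auto simp: star_def doubleton_eq_iff)
  have lt: "f v < n" if "v \<in> verts G" for v
    using bij that by (auto dest: bij_betwE)
  have inj: "f u = f v \<longleftrightarrow> u = v" if "u \<in> verts G" "v \<in> verts G" for u v
    using bij that by (auto simp: bij_betw_def inj_on_def)
  have edge: "{u, v} \<in> edges G \<longleftrightarrow> u \<noteq> v \<and> (u = c \<or> v = c)"
    if "u \<in> verts G" "v \<in> verts G" for u v
    using that f edge0 lt inj c by metis
  have "edges G = {{c, w} | w. w \<in> verts G - {c}}"
  proof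
    show "edges G \<subseteq> {{c, w} | w. w \<in> verts G - {c}}"
    proof
      fix e assume e: "e \<in> edges G"
      then obtain u v where uv: "e = {u, v}" using edge_as_pair[OF sg] by blast
      with e have "u \<in> verts G" "v \<in> verts G" using edge_endpoints[OF sg] by auto
      with e uv edge show "e \<in> {{c, w} | w. w \<in> verts G - {c}}" by auto
    qed
    show "{{c, w} | w. w \<in> verts G - {c}} \<subseteq> edges G" using edge c by auto
  qed
  with c show "\<exists>c. star_centre G c" by (auto simp: star_centre_def)
next
  assume "\<exists>c. star_centre G c"
  then obtain c where c: "c \<in> verts G" and E: "edges G = {{c, w} | w. w \<in> verts G - {c}}"
    by (auto simp: star_centre_def)
  have "finite (verts G)" using sg by (simp add: simple_graph_def)
  then have "card (verts G - {c}) = card {1..<n}" using c n by simp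
  then obtain g where g: "bij_betw g (verts G - {c}) {1..<n}"
    using \<open>finite (verts G)\<close> finite_same_card_bij[of "verts G - {c}" "{1..<n}"] by auto
  define f where "f = g(c := 0)"
  have "bij_betw f (verts G - {c}) {1..<n}"
    using g by (rule bij_betw_cong[THEN iffD1, rotated]) (simp add: f_def)
  then have "bij_betw f (insert c (verts G - {c})) (insert 0 {1..<n})"
    using notIn_Un_bij_betw[of c "verts G - {c}" f "{1..<n}"] by (simp add: f_def)
  moreover have "insert c (verts G - {c}) = verts G" "insert 0 {1..<n} = {0..<n}"
    using c n(2) by auto
  ultimately have bij: "bij_betw f (verts G) {0..<n}" by simp
  have zero: "f u = 0 \<longleftrightarrow> u = c" if "u \<in> verts G" for u
    using inj_on_eq_iff[OF bij_betw_imp_inj_on[OF bij] that c] by (simp add: f_def)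
  have lt: "f u < n" if "u \<in> verts G" for u
    using bij that by (auto dest: bij_betwE)
  have "{u, v} \<in> edges G \<longleftrightarrow> {f u, f v} \<in> edges (star n)"
    if uv: "u \<in> verts G" "v \<in> verts G" for u v
  proof -
    have "{u, v} \<in> edges G \<longleftrightarrow> (u = c \<and> v \<noteq> c) \<or> (v = c \<and> u \<noteq> c)"
      using E uv by (auto simp: doubleton_eq_iff)
    moreover have "{f u, f v} \<in> edges (star n) \<longleftrightarrow>
        (f u = 0 \<and> f v \<noteq> 0) \<or> (f v = 0 \<and> f u \<noteq> 0)"
      using lt[OF uv(1)] lt[OF uv(2)] by (auto simp: star_def doubleton_eq_iff)
    ultimately show ?thesis using zero uv by simp
  qed
  moreover have "verts (star n) = {0..<n}" by (simp add: star_def)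
  ultimately show "graph_iso G (star n)" unfolding graph_iso_def using bij by (intro exI[of _ f]) simp
qed

section \<open>The equality case\<close>

text \<open>A nontrivial connected graph has no isolated vertex, so a vertex that meets every edge
  must be adjacent to all the others.\<close>
lemma star_centre_if_all_edges_meet:
  assumes sg: "simple_graph G" and conn: "connected_graph G"
    and c: "c \<in> verts G" and meet: "\<And>e. e \<in> edges G \<Longrightarrow> c \<in> e"
  shows "star_centre G c"
proof -
  have "{c, w} \<in> edges G" if w: "w \<in> verts G" "w \<noteq> c" for w
  proof -
    have "(w, c) \<in> (adj_rel G)\<^sup>*" using conn c w by (auto simp: connected_graph_def)
    then obtain x where "(w, x) \<in> adj_rel G" using w(2) by (meson converse_rtranclE)
    then have wx: "{w, x} \<in> edges G" by (simp add: adj_rel_def)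
    with meet w(2) have "x = c" by auto
    with wx show ?thesis by (simp add: insert_commute)
  qed
  moreover have "\<exists>w. e = {c, w} \<and> w \<in> verts G - {c}" if e: "e \<in> edges G" for e
  proof -
    obtain u v where uv: "e = {u, v}" "u \<noteq> v" using edge_as_pair[OF sg e] .
    then have "u \<in> verts G" "v \<in> verts G" using e edge_endpoints[OF sg] by auto
    with uv meet[OF e] show ?thesis by (auto simp: insert_commute)
  qed
  ultimately show ?thesis using c by (auto simp: star_centre_def)
qed

lemma bipartite_no_triangle:
  assumes sg: "simple_graph G" and A: "A \<in> bipartition_classes G"
  shows "\<not> ({a, b} \<in> edges G \<and> {b, c} \<in> edges G \<and> {a, c} \<in> edges G)"
  using bipartition_class_alternates[OF A sg] by blast

lemma equality_imp_star_centre: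
  assumes sg: "simple_graph G" and conn: "connected_graph G"
    and eq: "card (independent_sets G) = 2 ^ (card (verts G) - 1) + 1"
  shows "\<exists>c. star_centre G c"
proof (cases "edges G = {}")
  case True
  obtain c where "c \<in> verts G" using conn by (auto simp: connected_graph_def)
  with True show ?thesis using star_centre_if_all_edges_meet[OF sg conn] by blast
next
  case False
  note half = equality_imp_bipartition_and_half_independent[OF sg conn eq]
  obtain A where A: "A \<in> bipartition_classes G" using half(1) by blast
  have meet: "e \<inter> e' \<noteq> {}" if e: "e \<in> edges G" "e' \<in> edges G" for e e'
  proof
    assume "e \<inter> e' = {}"
    then have "e \<subseteq> verts G" "e' \<subseteq> verts G - e" using e sg by (auto simp: simple_graph_def)
    then show False using half(2)[of e] e by (auto simp: independent_sets_def)
  qed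
  obtain a b where ab: "{a, b} \<in> edges G" using False edge_as_pair[OF sg] by (metis ex_in_conv)
  have V: "a \<in> verts G" "b \<in> verts G" using edge_endpoints[OF sg ab] by auto
  have "(\<forall>e\<in>edges G. a \<in> e) \<or> (\<forall>e\<in>edges G. b \<in> e)"
    \<comment> \<open>An edge avoiding \<open>a\<close> and an edge avoiding \<open>b\<close> would close a triangle over \<open>{a, b}\<close>.\<close>
  proof (rule ccontr)
    assume "\<not> ?thesis"
    then obtain e e' where e: "e \<in> edges G" "a \<notin> e" and e': "e' \<in> edges G" "b \<notin> e'" by blast
    have be: "b \<in> e" using meet[OF ab e(1)] e(2) by auto
    have ae': "a \<in> e'" using meet[OF ab e'(1)] e'(2) by auto
    obtain c where c: "e = {b, c}"
      using edge_as_pair[OF sg e(1)] be by (metis insert_commute insertE singletonD)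
    obtain d where d: "e' = {a, d}"
      using edge_as_pair[OF sg e'(1)] ae' by (metis insert_commute insertE singletonD)
    have "c = d" using meet[OF e(1) e'(1)] c d e(2) e'(2) by auto
    then show False using bipartite_no_triangle[OF sg A] ab e(1) e'(1) c d by blast
  qed
  then show ?thesis using star_centre_if_all_edges_meet[OF sg conn] V by blast
qed

theorem theorem2:
  fixes G :: "'a graph" and n :: nat
  assumes "simple_graph G" and "connected_graph G" and "order G = n"
  shows "real (sigma 1 G) / real (sigma 0 G) \<ge> real (sigma 1 (star n)) / real (sigma 0 (star n)) \<and>
    real (sigma 1 (star n)) / real (sigma 0 (star n)) = (real n - 1) / (2 ^ (n - 1) + 1) \<and>
    (real (sigma 1 G) / real (sigma 0 G) = real (sigma 1 (star n)) / real (sigma 0 (star n))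
      \<longleftrightarrow> graph_iso G (star n))"
proof -
  note sg = assms(1) and conn = assms(2)
  have n: "card (verts G) = n" using assms(3) by (simp add: order_def)
  have pos: "n > 0"
    using sg conn n by (auto simp: simple_graph_def connected_graph_def card_gt_0_iff)
  define N D :: nat where "N = n - 1" and "D = 2 ^ (n - 1) + 1"
  have star: "sigma 1 (star n) = N" "sigma 0 (star n) = D"
    using sigma_1_star[OF simple_graph_star star_centre_star[OF pos]]
      card_independent_sets_star[OF simple_graph_star star_centre_star[OF pos]]
      sigma_0_eq[OF simple_graph_star, of n]
    by (simp_all add: N_def D_def star_def)
  have num: "N \<le> sigma 1 G"
    using connected_card_edges_ge[OF sg conn] card_edges_le_sigma_1[OF sg] n
    by (simp add: N_def)
  have den: "sigma 0 G \<le> D"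
    using card_independent_sets_le[OF sg conn] n by (simp add: D_def sigma_0_eq[OF sg])
  have den_pos: "sigma 0 G > 0" using sigma_0_pos[OF sg] .
  have ge: "real N / real D \<le> real (sigma 1 G) / real (sigma 0 G)"
    using num den den_pos by (intro frac_le) auto
  have iso: "graph_iso G (star n) \<longleftrightarrow> (\<exists>c. star_centre G c)"
    by (rule graph_iso_star_iff[OF sg n pos])
  have "\<exists>c. star_centre G c" if eq: "real (sigma 1 G) / real (sigma 0 G) = real N / real D"
  proof (cases "n = 1")
    \<comment> \<open>Here both ratios have numerator 0, so their equality says nothing about the denominators.\<close>
    case True
    then obtain c where c: "verts G = {c}" using n by (auto simp: card_1_singleton_iff)
    have "e \<notin> edges G" for e
    proof
      assume "e \<in> edges G"
      then have "card e = 2" "e \<subseteq> {c}" using sg c by (auto simp: simple_graph_def)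
      then show False using card_mono[of "{c}" e] by simp
    qed
    moreover have "c \<in> verts G" using c by simp
    ultimately have "star_centre G c"
      by (intro star_centre_if_all_edges_meet[OF sg conn]) auto
    then show ?thesis ..
  next
    case False
    then have "N > 0" using pos by (simp add: N_def)
    have "D > 0" by (simp add: D_def)
    have "real (sigma 1 G) * real D = real N * real (sigma 0 G)"
      using eq den_pos \<open>D > 0\<close> by (simp add: frac_eq_eq)
    then have "sigma 1 G * D = N * sigma 0 G" by (metis of_nat_eq_iff of_nat_mult)
    moreover have "N * D \<le> sigma 1 G * D" using num by simp
    ultimately have "D \<le> sigma 0 G" using \<open>N > 0\<close> by simp
    then have "card (independent_sets G) = 2 ^ (card (verts G) - 1) + 1"
      using den n by (simp add: D_def sigma_0_eq[OF sg])
    then show ?thesis by (rule equality_imp_star_centre[OF sg conn])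
  qed
  moreover have "real (sigma 1 G) / real (sigma 0 G) = real N / real D" if "star_centre G c" for c
    using sigma_1_star[OF sg that] card_independent_sets_star[OF sg that] n
    by (simp add: N_def D_def sigma_0_eq[OF sg])
  moreover have "real N / real D = (real n - 1) / (2 ^ (n - 1) + 1)"
    using pos by (simp add: N_def D_def of_nat_diff)
  ultimately show ?thesis using ge iso unfolding star by blast
qed

end
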